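(* Let $G$ be a finitely generated group and let $S=\{s_1,\dots,s_r\}\subseteq G\setminus\{e\}$ be a set of $r$ generators of $G$ such that the directed Cayley graph $\Gamma(G,S)$ is strongly connected. Let $s_{r+1}\in G\setminus\{e\}$ with $s_{r+1}\notin S$, and put $S'=S\cup\{s_{r+1}\}$. For $i\in\{1,\dots,r\}$, let $\kappa(e,s_i)$ (resp. $\kappa'(e,s_i)$) be the Lin--Lu--Yau Ricci curvature of the arc $(e,s_i)$ in $\Gamma(G,S)$ (resp. in $\Gamma(G,S')$), and let $d_{S'}$ denote the directed distance in $\Gamma(G,S')$. If $$\kappa(e,s_i)\le 1-d_{S'}(s_{r+1},s_is_{r+1}),$$ then $\kappa'(e,s_i)\ge\kappa(e,s_i)$.
   Context: For a group $G$ with identity $e$ and a finite set $S\subseteq G\setminus\{e\}$, the directed Cayley graph $\Gamma(G,S)$ has vertex set $G$ and arcs $(g,gs)$ for $g\in G$, $s\in S$. In a simple directed graph $(V,\mathcal A)$, $N^{\rm out}(x)=\{v\in V:(x,v)\in\mathcal A\}$, $d^{\rm out}_x=|N^{\rm out}(x)|$, and $d(x,y)$ is the length of a shortest directed path from $x$ to $y$; the graph is strongly connected if $d(x,y)<\infty$ for all $x,y$. For $\alpha\in[0,1]$, the $\alpha$-lazy random walk measure at $x$ is $\mu^\alpha_x(x)=\alpha$, $\mu^\alpha_x(v)=\frac{1-\alpha}{d^{\rm out}_x}$ if $(x,v)\in\mathcal A$, and $\mu_x^\alpha(v)=0$ otherwise. For probability measures $\mu,\nu$ on $V$, $W(\mu,\nu)=\inf_A\sum_{u,v\in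 V}A(u,v)d(u,v)$, the infimum over couplings $A:V\times V\to[0,1]$ with $\sum_{v}A(u,v)=\mu(u)$ for all $u$ and $\sum_uA(u,v)=\nu(v)$ for all $v$. For distinct $x,y$, $\kappa_\alpha(x,y)=1-\frac{W(\mu_x^\alpha,\mu_y^\alpha)}{d(x,y)}$, and the Lin--Lu--Yau Ricci curvature is $\kappa(x,y)=\lim_{\alpha\to1^-}\frac{\kappa_\alpha(x,y)}{1-\alpha}$. *)

theory Defs
  imports
    "HOL-Algebra.Generated_Groups"
    "HOL-Analysis.Analysis"
    "Graph_Theory.Pair_Digraph"
    "Graph_Theory.Digraph_Component"
    "Graph_Theory.Shortest_Path"
begin

definition cayley_digraph :: "('a, 'm) monoid_scheme \<Rightarrow> 'a set \<Rightarrow> 'a pair_pre_digraph" where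
  "cayley_digraph G S =
     \<lparr> pverts = carrier G, parcs = {(g, g \<otimes>\<^bsub>G\<^esub> s) | g s. g \<in> carrier G \<and> s \<in> S} \<rparr>"

lemma cayley_digraph_wf:
  assumes "group G" and "S \<subseteq> carrier G"
  shows "wf_digraph (with_proj (cayley_digraph G S))"
proof -
  interpret group G by fact
  show ?thesis
    using assms(2) by unfold_locales (auto simp: cayley_digraph_def)
qed

lemma cayley_digraph_loopfree:
  assumes "group G" and "S \<subseteq> carrier G - {\<one>\<^bsub>G\<^esub>}"
  shows "pair_loopfree_digraph (cayley_digraph G S)"
proof -
  interpret group G by fact
  show ?thesis
    using assms(2) by unfold_locales (auto simp: cayley_digraph_def)
qed


text \<open>
  The directed distance is the library's shortest-path weight for unit arc weights; it is
  infinite if there is no directed path.  The library constant is specified for well-formed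
  digraphs only.
\<close>

definition ddist :: "'a pair_pre_digraph \<Rightarrow> 'a \<Rightarrow> 'a \<Rightarrow> ereal" where
  "ddist \<Gamma> u v = wf_digraph.\<mu> (with_proj \<Gamma>) (\<lambda>_. 1) u v"

lemma ddist_eq:
  assumes "wf_digraph (with_proj \<Gamma>)"
  shows "ddist \<Gamma> u v =
    (INF p \<in> {p. pre_digraph.awalk (with_proj \<Gamma>) u p v}. ereal (real (length p)))"
proof -
  interpret wf_digraph "with_proj \<Gamma>" by fact
  have "awalk_cost (\<lambda>_. 1) p = real (length p)" for p
    by (induction p) auto
  then show ?thesis
    by (simp add: ddist_def \<mu>_def)
qed

definition out_nbrs :: "'a pair_pre_digraph \<Rightarrow> 'a \<Rightarrow> 'a set" where
  "out_nbrs \<Gamma> x = {v \<in> pverts \<Gamma>. (x, v) \<in> parcs \<Gamma>}"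

definition lazy_walk :: "'a pair_pre_digraph \<Rightarrow> real \<Rightarrow> 'a \<Rightarrow> 'a \<Rightarrow> real" where
  "lazy_walk \<Gamma> \<alpha> x v =
     (if v = x then \<alpha>
      else if (x, v) \<in> parcs \<Gamma> then (1 - \<alpha>) / real (card (out_nbrs \<Gamma> x))
      else 0)"

definition couplings ::
    "'a pair_pre_digraph \<Rightarrow> ('a \<Rightarrow> real) \<Rightarrow> ('a \<Rightarrow> real) \<Rightarrow> ('a \<Rightarrow> 'a \<Rightarrow> real) set" where
  "couplings \<Gamma> \<mu> \<nu> =
     {A. (\<forall>u \<in> pverts \<Gamma>. \<forall>v \<in> pverts \<Gamma>. 0 \<le> A u v \<and> A u v \<le> 1) \<and>
         (\<forall>u \<in> pverts \<Gamma>. ((\<lambda>v. A u v) has_sum \<mu> u) (pverts \<Gamma>)) \<and>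
         (\<forall>v \<in> pverts \<Gamma>. ((\<lambda>u. A u v) has_sum \<nu> v) (pverts \<Gamma>))}"

text \<open>
  The cost is summed in the extended reals, where a sum of nonnegative terms always exists,
  so that a coupling of infinite cost is not counted as one of cost 0.
\<close>

definition wasserstein ::
    "'a pair_pre_digraph \<Rightarrow> ('a \<Rightarrow> real) \<Rightarrow> ('a \<Rightarrow> real) \<Rightarrow> ereal" where
  "wasserstein \<Gamma> \<mu> \<nu> =
     (INF A \<in> couplings \<Gamma> \<mu> \<nu>.
        \<Sum>\<^sub>\<infinity>(u, v) \<in> pverts \<Gamma> \<times> pverts \<Gamma>. ereal (A u v) * ddist \<Gamma> u v)"

text \<open>
  The curvatures are meant for distinct vertices of a strongly connected digraph with finite
  out-degrees; there both extended reals below are finite and the conversions lose nothing.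
\<close>

definition lazy_curvature :: "'a pair_pre_digraph \<Rightarrow> real \<Rightarrow> 'a \<Rightarrow> 'a \<Rightarrow> real" where
  "lazy_curvature \<Gamma> \<alpha> x y =
     1 - real_of_ereal (wasserstein \<Gamma> (lazy_walk \<Gamma> \<alpha> x) (lazy_walk \<Gamma> \<alpha> y))
         / real_of_ereal (ddist \<Gamma> x y)"

definition LLY_curvature :: "'a pair_pre_digraph \<Rightarrow> 'a \<Rightarrow> 'a \<Rightarrow> real" where
  "LLY_curvature \<Gamma> x y = Lim (at_left 1) (\<lambda>\<alpha>. lazy_curvature \<Gamma> \<alpha> x y / (1 - \<alpha>))"

end

theory Submission
  imports Defs
begin

text \<open>
  Write \<open>n\<close> for the number of generators, \<open>t\<close> for the new one and \<open>y\<close> for the generator of the arc.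
  Choose \<open>\<beta>\<close> with \<open>(1 - \<beta>) / n = (1 - \<alpha>) / (n + 1) = c\<close>.  The \<open>\<alpha>\<close>-lazy walk on the larger graph then
  arises from the \<open>\<beta>\<close>-lazy walk on the smaller one by moving the mass \<open>c\<close> from the current vertex to
  its new neighbour.  For \<open>\<alpha>\<close> near 1 every coupling of the walks at the identity and at \<open>y\<close> puts mass
  at least \<open>c\<close> on the pair \<open>(1, y)\<close>, which is at distance 1; moving it to the pair \<open>(t, y t)\<close> gives
  \<open>W' \<le> W - c + c d'(t, y t)\<close>.  Dividing by \<open>1 - \<alpha>\<close> and letting \<open>\<alpha> \<rightarrow> 1\<close>,
  \<open>\<kappa>' \<ge> n / (n + 1) * \<kappa> + 1 / (n + 1) * (1 - d'(t, y t))\<close>, and the last bracket is at least \<open>\<kappa>\<close>.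
\<close>

section \<open>Directed distances and their real values\<close>

lemma ddist_nonneg:
  assumes "wf_digraph (with_proj \<Gamma>)"
  shows "0 \<le> ddist \<Gamma> u v"
  unfolding ddist_eq[OF assms] by (rule INF_greatest) simp

lemma ddist_less_infinity:
  assumes "wf_digraph (with_proj \<Gamma>)" and "strongly_connected (with_proj \<Gamma>)"
    and "u \<in> pverts \<Gamma>" and "v \<in> pverts \<Gamma>"
  shows "ddist \<Gamma> u v < \<infinity>"
proof -
  interpret wf_digraph "with_proj \<Gamma>" by fact
  have "u \<rightarrow>\<^sup>*\<^bsub>with_proj \<Gamma>\<^esub> v"
    using assms(2-4) by (simp add: strongly_connected_def)
  then show ?thesis
    unfolding ddist_def by (simp only: \<mu>_reach_conv)
qed

lemma ddist_ge_1:
  assumes "wf_digraph (with_proj \<Gamma>)" and "u \<noteq> v"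
  shows "1 \<le> ddist \<Gamma> u v"
  unfolding ddist_eq[OF assms(1)]
proof (rule INF_greatest)
  interpret wf_digraph "with_proj \<Gamma>" by fact
  fix p assume "p \<in> {p. awalk u p v}"
  then have "p \<noteq> []"
    using assms(2) by (auto simp: awalk_Nil_iff)
  then have "1 \<le> real (length p)"
    by (cases p) auto
  then show "1 \<le> ereal (real (length p))"
    by (metis ereal_less_eq(3) one_ereal_def)
qed

lemma ddist_arc:
  assumes "wf_digraph (with_proj \<Gamma>)" and "(u, v) \<in> parcs \<Gamma>" and "u \<noteq> v"
  shows "ddist \<Gamma> u v = 1"
proof (rule antisym)
  interpret wf_digraph "with_proj \<Gamma>" by fact
  have "awalk u [(u, v)] v"
    using assms(2) wellformed(2)[of "(u, v)"] by (auto simp: awalk_simps)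
  then show "ddist \<Gamma> u v \<le> 1"
    unfolding ddist_eq[OF assms(1)] by (intro INF_lower2[of "[(u, v)]"]) (auto simp: one_ereal_def)
qed (rule ddist_ge_1[OF assms(1,3)])

lemma ddist_subgraph_le:
  assumes "wf_digraph (with_proj \<Gamma>')" and "subgraph (with_proj \<Gamma>) (with_proj \<Gamma>')"
  shows "ddist \<Gamma>' u v \<le> ddist \<Gamma> u v"
proof -
  interpret wf_digraph "with_proj \<Gamma>'" by fact
  have "wf_digraph (with_proj \<Gamma>)"
    using assms(2) by (auto simp: subgraph_def)
  then show ?thesis
    unfolding ddist_eq[OF assms(1)] ddist_eq[OF \<open>wf_digraph (with_proj \<Gamma>)\<close>]
    using subgraph_awalk_imp_awalk[OF _ assms(2)] by (intro INF_superset_mono) auto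
qed

text \<open>A real version of the distance, so that costs can be treated by real arithmetic. Since
  \<open>real_of_ereal\<close> sends infinity to 0, the value is meaningful only where a directed
  path exists; \<open>ereal_rdist\<close> secures this by strong connectivity.\<close>

definition rdist :: "'a pair_pre_digraph \<Rightarrow> 'a \<Rightarrow> 'a \<Rightarrow> real" where
  "rdist \<Gamma> u v = real_of_ereal (ddist \<Gamma> u v)"

lemma rdist_nonneg:
  assumes "wf_digraph (with_proj \<Gamma>)"
  shows "0 \<le> rdist \<Gamma> u v"
  using ddist_nonneg[OF assms] by (simp add: rdist_def real_of_ereal_pos)

lemma ereal_rdist:
  assumes "wf_digraph (with_proj \<Gamma>)" and "strongly_connected (with_proj \<Gamma>)"
    and "u \<in> pverts \<Gamma>" and "v \<in> pverts \<Gamma>"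
  shows "ereal (rdist \<Gamma> u v) = ddist \<Gamma> u v"
  using ddist_nonneg[OF assms(1), of u v] ddist_less_infinity[OF assms]
  by (cases "ddist \<Gamma> u v") (auto simp: rdist_def)

section \<open>Couplings: support, construction, lower bounds on entries\<close>

lemma couplings_nonneg:
  assumes "A \<in> couplings \<Gamma> \<mu> \<nu>" and "u \<in> pverts \<Gamma>" and "v \<in> pverts \<Gamma>"
  shows "0 \<le> A u v"
  using assms by (simp add: couplings_def)

text \<open>A row or column of nonnegative entries with sum 0 vanishes. For finitely supported
  marginals this reduces the infinite cost sum to a finite one.\<close>

lemma couplings_support:
  assumes "A \<in> couplings \<Gamma> \<mu> \<nu>" and "u \<in> pverts \<Gamma>" and "v \<in> pverts \<Gamma>"
    and "\<mu> u = 0 \<or> \<nu> v = 0"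
  shows "A u v = 0"
  using assms(4)
proof
  assume "\<mu> u = 0"
  then show ?thesis
    using assms(1-3) by (intro nonneg_has_sum_le_0D[of "A u" "pverts \<Gamma>" "\<mu> u" v])
      (auto simp: couplings_def)
next
  assume "\<nu> v = 0"
  then show ?thesis
    using assms(1-3) by (intro nonneg_has_sum_le_0D[of "\<lambda>u. A u v" "pverts \<Gamma>" "\<nu> v" u])
      (auto simp: couplings_def)
qed

text \<open>The upper bound 1 on the entries comes for free: a nonnegative entry is at most its row
  sum.\<close>

lemma couplings_intro:
  assumes "\<And>u v. u \<in> pverts \<Gamma> \<Longrightarrow> v \<in> pverts \<Gamma> \<Longrightarrow> 0 \<le> A u v"
    and "\<And>u. u \<in> pverts \<Gamma> \<Longrightarrow> \<mu> u \<le> 1"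
    and "\<And>u. u \<in> pverts \<Gamma> \<Longrightarrow> (A u has_sum \<mu> u) (pverts \<Gamma>)"
    and "\<And>v. v \<in> pverts \<Gamma> \<Longrightarrow> ((\<lambda>u. A u v) has_sum \<nu> v) (pverts \<Gamma>)"
  shows "A \<in> couplings \<Gamma> \<mu> \<nu>"
proof -
  have "A u v \<le> 1" if "u \<in> pverts \<Gamma>" "v \<in> pverts \<Gamma>" for u v
  proof -
    have "(A u has_sum A u v) {v}"
      by (simp add: has_sum_finite_iff)
    then have "A u v \<le> \<mu> u"
      by (rule has_sum_mono'[OF _ assms(3)[OF that(1)]]) (use that assms(1) in auto)
    then show ?thesis
      using assms(2)[OF that(1)] by linarith
  qed
  then show ?thesis
    using assms by (simp add: couplings_def)
qed

text \<open>Only the entry at \<open>(a, b)\<close> can turn negative when \<open>c < 0\<close>, so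
  one inequality there suffices. The marginals need not have total mass 1, which allows mass to be
  removed in one step and put back elsewhere in the next.\<close>

lemma couplings_point_mass:
  assumes A: "A \<in> couplings \<Gamma> \<mu> \<nu>" and a: "a \<in> pverts \<Gamma>" and b: "b \<in> pverts \<Gamma>"
    and t: "0 \<le> t" and nonneg: "0 \<le> t * A a b + c"
    and le1: "\<And>u. u \<in> pverts \<Gamma> \<Longrightarrow> t * \<mu> u + (if u = a then c else 0) \<le> 1"
  shows "(\<lambda>u v. t * A u v + (if u = a \<and> v = b then c else 0)) \<in>
    couplings \<Gamma> (\<lambda>u. t * \<mu> u + (if u = a then c else 0))
      (\<lambda>v. t * \<nu> v + (if v = b then c else 0))"
proof (rule couplings_intro)
  show "0 \<le> t * A u v + (if u = a \<and> v = b then c else 0)"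
    if "u \<in> pverts \<Gamma>" "v \<in> pverts \<Gamma>" for u v
    using couplings_nonneg[OF A that] t nonneg by auto
next
  fix u assume "u \<in> pverts \<Gamma>"
  then have "((\<lambda>v. t * A u v) has_sum t * \<mu> u) (pverts \<Gamma>)"
    using A by (intro has_sum_cmult_right) (simp add: couplings_def)
  moreover have "((\<lambda>v. if u = a \<and> v = b then c else 0) has_sum (if u = a then c else 0)) (pverts \<Gamma>)"
    using b by (intro has_sum_finite_neutralI[of "{b}"]) auto
  ultimately show "((\<lambda>v. t * A u v + (if u = a \<and> v = b then c else 0)) has_sum
      t * \<mu> u + (if u = a then c else 0)) (pverts \<Gamma>)"
    by (rule has_sum_add)
next
  fix v assume "v \<in> pverts \<Gamma>"
  then have "((\<lambda>u. t * A u v) has_sum t * \<nu> v) (pverts \<Gamma>)"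
    using A by (intro has_sum_cmult_right) (simp add: couplings_def)
  moreover have "((\<lambda>u. if u = a \<and> v = b then c else 0) has_sum (if v = b then c else 0)) (pverts \<Gamma>)"
    using a by (intro has_sum_finite_neutralI[of "{a}"]) auto
  ultimately show "((\<lambda>u. t * A u v + (if u = a \<and> v = b then c else 0)) has_sum
      t * \<nu> v + (if v = b then c else 0)) (pverts \<Gamma>)"
    by (rule has_sum_add)
qed (rule le1)

text \<open>The independent coupling is a witness. Nonemptiness is what makes the infimum of the
  costs a real number.\<close>

lemma couplings_nonempty:
  assumes "(\<mu> has_sum 1) (pverts \<Gamma>)" and "(\<nu> has_sum 1) (pverts \<Gamma>)"
    and "\<And>u. 0 \<le> \<mu> u" and "\<And>u. \<mu> u \<le> 1" and "\<And>v. 0 \<le> \<nu> v"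
  shows "couplings \<Gamma> \<mu> \<nu> \<noteq> {}"
proof -
  have "(\<lambda>u v. \<mu> u * \<nu> v) \<in> couplings \<Gamma> \<mu> \<nu>"
  proof (rule couplings_intro)
    show "((\<lambda>v. \<mu> u * \<nu> v) has_sum \<mu> u) (pverts \<Gamma>)" for u
      using has_sum_cmult_right[OF assms(2), of "\<mu> u"] by simp
    show "((\<lambda>u. \<mu> u * \<nu> v) has_sum \<nu> v) (pverts \<Gamma>)" for v
      using has_sum_cmult_left[OF assms(1), of "\<nu> v"] by simp
  qed (simp_all add: assms(3-5))
  then show ?thesis by blast
qed

text \<open>In row \<open>a\<close>, the entries outside column \<open>b\<close> are bounded by the
  values of \<nu> there, which add up to \<open>1 - \<nu> b\<close>. The rest of the row sum
  \<open>\<mu> a\<close> has to sit at \<open>(a, b)\<close>.\<close>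

lemma coupling_entry_ge:
  assumes A: "A \<in> couplings \<Gamma> \<mu> \<nu>" and a: "a \<in> pverts \<Gamma>" and b: "b \<in> pverts \<Gamma>"
    and \<nu>: "(\<nu> has_sum 1) (pverts \<Gamma>)"
  shows "\<mu> a + \<nu> b - 1 \<le> A a b"
proof -
  have le: "A a v \<le> \<nu> v" if "v \<in> pverts \<Gamma>" for v
  proof -
    have "((\<lambda>u. A u v) has_sum A a v) {a}"
      by (simp add: has_sum_finite_iff)
    moreover have "((\<lambda>u. A u v) has_sum \<nu> v) (pverts \<Gamma>)"
      using A that by (simp add: couplings_def)
    ultimately show ?thesis
      by (rule has_sum_mono') (use a that couplings_nonneg[OF A] in auto)
  qed
  \<comment> \<open>Correcting \<nu> at \<open>b\<close> alone gives a function that dominates row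
    \<open>a\<close> everywhere and equals it at \<open>b\<close>.\<close>
  have "((\<lambda>v. if v = b then A a b - \<nu> b else 0) has_sum (A a b - \<nu> b)) (pverts \<Gamma>)"
    using b by (intro has_sum_finite_neutralI[of "{b}"]) auto
  from has_sum_add[OF \<nu> this]
  have upper: "((\<lambda>v. \<nu> v + (if v = b then A a b - \<nu> b else 0)) has_sum (1 + (A a b - \<nu> b))) (pverts \<Gamma>)" .
  have row: "(A a has_sum \<mu> a) (pverts \<Gamma>)"
    using A a by (simp add: couplings_def)
  have "\<mu> a \<le> 1 + (A a b - \<nu> b)"
  proof (rule has_sum_mono[OF row upper])
    show "A a v \<le> \<nu> v + (if v = b then A a b - \<nu> b else 0)" if "v \<in> pverts \<Gamma>" for v
      using le[OF that] by simp
  qed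
  then show ?thesis by linarith
qed

section \<open>Transport cost as a finite sum and the Wasserstein distance as a real infimum\<close>

definition transport_cost :: "'a pair_pre_digraph \<Rightarrow> ('a \<times> 'a) set \<Rightarrow> ('a \<Rightarrow> 'a \<Rightarrow> real) \<Rightarrow> real" where
  "transport_cost \<Gamma> F A = (\<Sum>(u, v)\<in>F. A u v * rdist \<Gamma> u v)"

definition support_pairs :: "'a pair_pre_digraph \<Rightarrow> ('a \<Rightarrow> real) \<Rightarrow> ('a \<Rightarrow> real) \<Rightarrow> ('a \<times> 'a) set" where
  "support_pairs \<Gamma> \<mu> \<nu> = {u \<in> pverts \<Gamma>. \<mu> u \<noteq> 0} \<times> {v \<in> pverts \<Gamma>. \<nu> v \<noteq> 0}"

lemma finite_support_pairs:
  assumes "finite {u \<in> pverts \<Gamma>. \<mu> u \<noteq> 0}" and "finite {v \<in> pverts \<Gamma>. \<nu> v \<noteq> 0}"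
  shows "finite (support_pairs \<Gamma> \<mu> \<nu>)"
  using assms by (simp add: support_pairs_def)

lemma finite_point_mass:
  fixes \<mu> :: "'a \<Rightarrow> real"
  assumes "finite {u \<in> V. \<mu> u \<noteq> 0}"
  shows "finite {u \<in> V. t * \<mu> u + (if u = a then c else 0) \<noteq> 0}"
proof (rule finite_subset)
  show "{u \<in> V. t * \<mu> u + (if u = a then c else 0) \<noteq> 0} \<subseteq> insert a {u \<in> V. \<mu> u \<noteq> 0}"
    by (auto split: if_splits)
  show "finite (insert a {u \<in> V. \<mu> u \<noteq> 0})"
    using assms by simp
qed

lemma transport_cost_nonneg:
  assumes "wf_digraph (with_proj \<Gamma>)" and "A \<in> couplings \<Gamma> \<mu> \<nu>"
    and "F \<subseteq> pverts \<Gamma> \<times> pverts \<Gamma>"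
  shows "0 \<le> transport_cost \<Gamma> F A"
  unfolding transport_cost_def
  using assms(3) by (intro sum_nonneg)
    (auto intro!: mult_nonneg_nonneg couplings_nonneg[OF assms(2)] rdist_nonneg[OF assms(1)])

lemma transport_cost_bdd_below:
  assumes "wf_digraph (with_proj \<Gamma>)" and "F \<subseteq> pverts \<Gamma> \<times> pverts \<Gamma>"
  shows "bdd_below (transport_cost \<Gamma> F ` couplings \<Gamma> \<mu> \<nu>)"
  using transport_cost_nonneg[OF assms(1) _ assms(2)] by (auto intro!: bdd_belowI[of _ 0])

text \<open>A coupling vanishes outside the product of the supports, and on \<open>F\<close> all
  distances are finite, so the extended real sum is a finite real one.\<close>

lemma infsum_coupling_cost:
  assumes wf: "wf_digraph (with_proj \<Gamma>)" and sc: "strongly_connected (with_proj \<Gamma>)"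
    and A: "A \<in> couplings \<Gamma> \<mu> \<nu>"
    and F: "finite F" "F \<subseteq> pverts \<Gamma> \<times> pverts \<Gamma>" "support_pairs \<Gamma> \<mu> \<nu> \<subseteq> F"
  shows "(\<Sum>\<^sub>\<infinity>(u, v)\<in>pverts \<Gamma> \<times> pverts \<Gamma>. ereal (A u v) * ddist \<Gamma> u v) =
    ereal (transport_cost \<Gamma> F A)"
proof -
  have "(\<Sum>\<^sub>\<infinity>(u, v)\<in>pverts \<Gamma> \<times> pverts \<Gamma>. ereal (A u v) * ddist \<Gamma> u v) =
      (\<Sum>\<^sub>\<infinity>(u, v)\<in>F. ereal (A u v * rdist \<Gamma> u v))"
  proof (rule infsum_cong_neutral)
    fix p assume p: "p \<in> pverts \<Gamma> \<times> pverts \<Gamma> - F"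
    obtain u v where uv: "p = (u, v)" by (cases p)
    have "A u v = 0"
      using p F(3) by (intro couplings_support[OF A]) (auto simp: uv support_pairs_def)
    then show "(case p of (u, v) \<Rightarrow> ereal (A u v) * ddist \<Gamma> u v) = 0"
      by (simp add: uv zero_ereal_def[symmetric])
  next
    fix p assume "p \<in> (pverts \<Gamma> \<times> pverts \<Gamma>) \<inter> F"
    then show "(case p of (u, v) \<Rightarrow> ereal (A u v) * ddist \<Gamma> u v) =
        (case p of (u, v) \<Rightarrow> ereal (A u v * rdist \<Gamma> u v))"
      using ereal_rdist[OF wf sc] by (auto simp flip: times_ereal.simps(1))
  qed (use F(2) in auto)
  also have "\<dots> = (\<Sum>(u, v)\<in>F. ereal (A u v * rdist \<Gamma> u v))"
    by (rule infsum_finite[OF F(1)])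
  also have "\<dots> = ereal (transport_cost \<Gamma> F A)"
    by (simp add: transport_cost_def case_prod_unfold)
  finally show ?thesis .
qed

definition rwasserstein :: "'a pair_pre_digraph \<Rightarrow> ('a \<Rightarrow> real) \<Rightarrow> ('a \<Rightarrow> real) \<Rightarrow> real" where
  "rwasserstein \<Gamma> \<mu> \<nu> = real_of_ereal (wasserstein \<Gamma> \<mu> \<nu>)"

text \<open>The set \<open>F\<close> may be any finite superset of the support pairs, so that costs
  for different pairs of measures can be compared as sums over one common set. Without couplings the
  extended infimum would be infinite and its real value the default 0.\<close>

lemma rwasserstein_eq:
  assumes wf: "wf_digraph (with_proj \<Gamma>)" and sc: "strongly_connected (with_proj \<Gamma>)"
    and ne: "couplings \<Gamma> \<mu> \<nu> \<noteq> {}"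
    and F: "finite F" "F \<subseteq> pverts \<Gamma> \<times> pverts \<Gamma>" "support_pairs \<Gamma> \<mu> \<nu> \<subseteq> F"
  shows "rwasserstein \<Gamma> \<mu> \<nu> = (INF A\<in>couplings \<Gamma> \<mu> \<nu>. transport_cost \<Gamma> F A)"
proof -
  have "wasserstein \<Gamma> \<mu> \<nu> = (INF A\<in>couplings \<Gamma> \<mu> \<nu>. ereal (transport_cost \<Gamma> F A))"
    unfolding wasserstein_def
    using infsum_coupling_cost[OF wf sc _ F] by (intro INF_cong) auto
  also have "\<dots> = ereal (INF A\<in>couplings \<Gamma> \<mu> \<nu>. transport_cost \<Gamma> F A)"
    using ereal_Inf'[OF transport_cost_bdd_below[OF wf F(2)], of \<mu> \<nu>] ne
    by (simp add: image_comp)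
  finally show ?thesis
    by (simp add: rwasserstein_def)
qed

text \<open>Both digraphs have the same vertices and hence the same couplings; extra arcs can only
  shorten distances, so each coupling becomes no more expensive.\<close>

lemma rwasserstein_mono_dist:
  assumes wf: "wf_digraph (with_proj \<Gamma>)" and sc: "strongly_connected (with_proj \<Gamma>)"
    and wf': "wf_digraph (with_proj \<Gamma>')" and sc': "strongly_connected (with_proj \<Gamma>')"
    and sub: "subgraph (with_proj \<Gamma>) (with_proj \<Gamma>')" and verts: "pverts \<Gamma>' = pverts \<Gamma>"
    and ne: "couplings \<Gamma> \<mu> \<nu> \<noteq> {}"
    and fin: "finite {u \<in> pverts \<Gamma>. \<mu> u \<noteq> 0}" "finite {v \<in> pverts \<Gamma>. \<nu> v \<noteq> 0}"
  shows "rwasserstein \<Gamma>' \<mu> \<nu> \<le> rwasserstein \<Gamma> \<mu> \<nu>"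
proof -
  have cpl: "couplings \<Gamma>' \<mu> \<nu> = couplings \<Gamma> \<mu> \<nu>"
    and supp: "support_pairs \<Gamma>' \<mu> \<nu> = support_pairs \<Gamma> \<mu> \<nu>"
    by (simp_all add: couplings_def support_pairs_def verts)
  define F where "F = support_pairs \<Gamma> \<mu> \<nu>"
  have F: "finite F" "F \<subseteq> pverts \<Gamma> \<times> pverts \<Gamma>" "support_pairs \<Gamma> \<mu> \<nu> \<subseteq> F"
    using finite_support_pairs[OF fin] by (auto simp: F_def support_pairs_def)
  have "rdist \<Gamma>' u v \<le> rdist \<Gamma> u v" if "u \<in> pverts \<Gamma>" "v \<in> pverts \<Gamma>" for u v
    using ddist_subgraph_le[OF wf' sub, of u v] that verts
      ereal_rdist[OF wf sc, of u v] ereal_rdist[OF wf' sc', of u v]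
    by (metis ereal_less_eq(3))
  then have "transport_cost \<Gamma>' F A \<le> transport_cost \<Gamma> F A" if "A \<in> couplings \<Gamma> \<mu> \<nu>" for A
    unfolding transport_cost_def using F(2) couplings_nonneg[OF that]
    by (intro sum_mono) (auto intro!: mult_left_mono)
  then have "(INF A\<in>couplings \<Gamma> \<mu> \<nu>. transport_cost \<Gamma>' F A) \<le>
      (INF A\<in>couplings \<Gamma> \<mu> \<nu>. transport_cost \<Gamma> F A)"
    using transport_cost_bdd_below[OF wf', of F \<mu> \<nu>] F(2) ne
    by (intro cINF_mono) (auto simp: cpl verts)
  then show ?thesis
    using rwasserstein_eq[OF wf sc ne F] rwasserstein_eq[OF wf' sc', of \<mu> \<nu> F] F ne
    by (simp add: cpl supp verts)
qed

text \<open>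
  The coefficient \<open>c\<close> may be negative: mass can be removed from the pair \<open>(a, b)\<close> as long as every
  coupling puts enough mass there.
\<close>

lemma rwasserstein_point_mass:
  assumes wf: "wf_digraph (with_proj \<Gamma>)" and sc: "strongly_connected (with_proj \<Gamma>)"
    and ne: "couplings \<Gamma> \<mu> \<nu> \<noteq> {}"
    and fin: "finite {u \<in> pverts \<Gamma>. \<mu> u \<noteq> 0}" "finite {v \<in> pverts \<Gamma>. \<nu> v \<noteq> 0}"
    and a: "a \<in> pverts \<Gamma>" and b: "b \<in> pverts \<Gamma>" and t: "0 < t"
    and nonneg: "\<And>A. A \<in> couplings \<Gamma> \<mu> \<nu> \<Longrightarrow> 0 \<le> t * A a b + c"
    and le1: "\<And>u. u \<in> pverts \<Gamma> \<Longrightarrow> t * \<mu> u + (if u = a then c else 0) \<le> 1"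
  defines "\<mu>' \<equiv> \<lambda>u. t * \<mu> u + (if u = a then c else 0)"
    and "\<nu>' \<equiv> \<lambda>v. t * \<nu> v + (if v = b then c else 0)"
  shows "couplings \<Gamma> \<mu>' \<nu>' \<noteq> {}"
    and "rwasserstein \<Gamma> \<mu>' \<nu>' \<le> t * rwasserstein \<Gamma> \<mu> \<nu> + c * rdist \<Gamma> a b"
proof -
  define shift :: "('a \<Rightarrow> 'a \<Rightarrow> real) \<Rightarrow> 'a \<Rightarrow> 'a \<Rightarrow> real"
    where "shift A = (\<lambda>u v. t * A u v + (if u = a \<and> v = b then c else 0))" for A
  have shift: "shift A \<in> couplings \<Gamma> \<mu>' \<nu>'" if "A \<in> couplings \<Gamma> \<mu> \<nu>" for A
    unfolding shift_def \<mu>'_def \<nu>'_def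
    using couplings_point_mass[OF that a b _ nonneg[OF that] le1] t by simp
  then show ne': "couplings \<Gamma> \<mu>' \<nu>' \<noteq> {}"
    using ne by blast
  have fin': "finite {u \<in> pverts \<Gamma>. \<mu>' u \<noteq> 0}" "finite {v \<in> pverts \<Gamma>. \<nu>' v \<noteq> 0}"
    unfolding \<mu>'_def \<nu>'_def using fin by (simp_all add: finite_point_mass)
  \<comment> \<open>This set serves the old measures, the new ones and the modified pair, so the
    cost of a shifted coupling is an affine function of the old cost.\<close>
  define F where "F = insert (a, b) (support_pairs \<Gamma> \<mu> \<nu> \<union> support_pairs \<Gamma> \<mu>' \<nu>')"
  have F: "finite F" "F \<subseteq> pverts \<Gamma> \<times> pverts \<Gamma>" "support_pairs \<Gamma> \<mu> \<nu> \<subseteq> F"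
      "support_pairs \<Gamma> \<mu>' \<nu>' \<subseteq> F"
    using finite_support_pairs[OF fin] finite_support_pairs[OF fin'] a b
    by (auto simp: F_def support_pairs_def)
  have cost: "transport_cost \<Gamma> F (shift A) = t * transport_cost \<Gamma> F A + c * rdist \<Gamma> a b" for A
  proof -
    have "transport_cost \<Gamma> F (shift A) = (\<Sum>p\<in>F. t * (A (fst p) (snd p) * rdist \<Gamma> (fst p) (snd p)) +
        (if p = (a, b) then c * rdist \<Gamma> a b else 0))"
      unfolding transport_cost_def shift_def
      by (intro sum.cong) (auto simp: algebra_simps split: if_splits)
    also have "\<dots> = t * transport_cost \<Gamma> F A + c * rdist \<Gamma> a b"
      using F(1) by (simp add: sum.distrib transport_cost_def case_prod_unfold sum_distrib_left F_def)
    finally show ?thesis .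
  qed
  \<comment> \<open>The affine relation is solved for the old cost, which makes the left side a
    lower bound independent of \<open>A\<close>.\<close>
  have "(rwasserstein \<Gamma> \<mu>' \<nu>' - c * rdist \<Gamma> a b) / t \<le> (INF A\<in>couplings \<Gamma> \<mu> \<nu>. transport_cost \<Gamma> F A)"
  proof (rule cINF_greatest[OF ne])
    fix A assume "A \<in> couplings \<Gamma> \<mu> \<nu>"
    then have "rwasserstein \<Gamma> \<mu>' \<nu>' \<le> transport_cost \<Gamma> F (shift A)"
      unfolding rwasserstein_eq[OF wf sc ne' F(1,2,4)]
      by (intro cINF_lower transport_cost_bdd_below[OF wf F(2)] shift)
    then show "(rwasserstein \<Gamma> \<mu>' \<nu>' - c * rdist \<Gamma> a b) / t \<le> transport_cost \<Gamma> F A"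
      using t by (simp add: cost field_simps)
  qed
  then show "rwasserstein \<Gamma> \<mu>' \<nu>' \<le> t * rwasserstein \<Gamma> \<mu> \<nu> + c * rdist \<Gamma> a b"
    unfolding rwasserstein_eq[OF wf sc ne F(1-3)] using t by (simp add: field_simps)
qed

section \<open>Lazy random walks\<close>

lemma lazy_walk_nonneg: "0 \<le> \<alpha> \<Longrightarrow> \<alpha> \<le> 1 \<Longrightarrow> 0 \<le> lazy_walk \<Gamma> \<alpha> x v"
  by (simp add: lazy_walk_def)

lemma lazy_walk_le_1:
  assumes "0 \<le> \<alpha>" and "\<alpha> \<le> 1"
  shows "lazy_walk \<Gamma> \<alpha> x v \<le> 1"
proof -
  have "(1 - \<alpha>) / real (card (out_nbrs \<Gamma> x)) \<le> 1"
    \<comment> \<open>For out-degree 0 the quotient is 0, as division by zero yields 0.\<close>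
    using assms by (cases "card (out_nbrs \<Gamma> x)") (auto simp: field_simps)
  then show ?thesis
    using assms by (simp add: lazy_walk_def)
qed

lemma finite_lazy_walk_support:
  assumes "finite (out_nbrs \<Gamma> x)"
  shows "finite {v \<in> pverts \<Gamma>. lazy_walk \<Gamma> \<alpha> x v \<noteq> 0}"
  by (rule finite_subset[of _ "insert x (out_nbrs \<Gamma> x)"])
    (use assms in \<open>auto simp: lazy_walk_def out_nbrs_def split: if_splits\<close>)

lemma lazy_walk_has_sum:
  assumes "x \<in> pverts \<Gamma>" and "finite (out_nbrs \<Gamma> x)" and "out_nbrs \<Gamma> x \<noteq> {}" and "x \<notin> out_nbrs \<Gamma> x"
  shows "(lazy_walk \<Gamma> \<alpha> x has_sum 1) (pverts \<Gamma>)"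
proof (rule has_sum_finite_neutralI[of "insert x (out_nbrs \<Gamma> x)"])
  have "(\<Sum>v\<in>out_nbrs \<Gamma> x. lazy_walk \<Gamma> \<alpha> x v) =
      (\<Sum>v\<in>out_nbrs \<Gamma> x. (1 - \<alpha>) / real (card (out_nbrs \<Gamma> x)))"
    using assms(4) by (intro sum.cong) (auto simp: lazy_walk_def out_nbrs_def)
  also have "\<dots> = 1 - \<alpha>"
    using assms(2,3) by simp
  finally show "1 = (\<Sum>v\<in>insert x (out_nbrs \<Gamma> x). lazy_walk \<Gamma> \<alpha> x v)"
    using assms(2,4) by (simp add: lazy_walk_def)
qed (use assms in \<open>auto simp: lazy_walk_def out_nbrs_def\<close>)

text \<open>The walk is affine in its laziness and becomes the point mass at \<open>x\<close> for
  laziness 1. The right-hand side has the form required by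
  \<open>rwasserstein_point_mass\<close>.\<close>

lemma lazy_walk_lazier:
  "lazy_walk \<Gamma> (t * \<alpha> + (1 - t)) x = (\<lambda>v. t * lazy_walk \<Gamma> \<alpha> x v + (if v = x then 1 - t else 0))"
proof -
  have "1 - (t * \<alpha> + (1 - t)) = t * (1 - \<alpha>)"
    by (simp add: right_diff_distrib)
  then show ?thesis
    by (simp add: fun_eq_iff lazy_walk_def)
qed

lemma couplings_lazy_walk_nonempty:
  assumes "x \<in> pverts \<Gamma>" "finite (out_nbrs \<Gamma> x)" "out_nbrs \<Gamma> x \<noteq> {}" "x \<notin> out_nbrs \<Gamma> x"
    and "y \<in> pverts \<Gamma>" "finite (out_nbrs \<Gamma> y)" "out_nbrs \<Gamma> y \<noteq> {}" "y \<notin> out_nbrs \<Gamma> y"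
    and "0 \<le> \<alpha>" and "\<alpha> \<le> 1"
  shows "couplings \<Gamma> (lazy_walk \<Gamma> \<alpha> x) (lazy_walk \<Gamma> \<alpha> y) \<noteq> {}"
  using assms by (intro couplings_nonempty lazy_walk_has_sum lazy_walk_nonneg lazy_walk_le_1)

section \<open>Existence of the limit defining the curvature\<close>

lemma lazy_curvature_eq:
  "lazy_curvature \<Gamma> \<alpha> x y =
    1 - rwasserstein \<Gamma> (lazy_walk \<Gamma> \<alpha> x) (lazy_walk \<Gamma> \<alpha> y) / rdist \<Gamma> x y"
  by (simp add: lazy_curvature_def rwasserstein_def rdist_def)

lemma rdist_pos:
  assumes "wf_digraph (with_proj \<Gamma>)" and "strongly_connected (with_proj \<Gamma>)"
    and "x \<in> pverts \<Gamma>" and "y \<in> pverts \<Gamma>" and "x \<noteq> y"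
  shows "0 < rdist \<Gamma> x y"
proof -
  have "ereal 1 \<le> ereal (rdist \<Gamma> x y)"
    using ddist_ge_1[OF assms(1,5)] by (simp only: ereal_rdist[OF assms(1-4)] flip: one_ereal_def)
  then show ?thesis by simp
qed

text \<open>Each walk keeps mass \<alpha> at its own starting vertex, so
  \<open>coupling_entry_ge\<close> applies with \<alpha> twice.\<close>

lemma coupling_lazy_walk_entry_ge:
  assumes "x \<in> pverts \<Gamma>" and "A \<in> couplings \<Gamma> (lazy_walk \<Gamma> \<alpha> x) (lazy_walk \<Gamma> \<alpha> y)"
    and "y \<in> pverts \<Gamma>" "finite (out_nbrs \<Gamma> y)" "out_nbrs \<Gamma> y \<noteq> {}" "y \<notin> out_nbrs \<Gamma> y"
  shows "2 * \<alpha> - 1 \<le> A x y"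
  using coupling_entry_ge[OF assms(2,1,3) lazy_walk_has_sum[OF assms(3-6)]]
  by (simp add: lazy_walk_def)

text \<open>
  The quotient is nondecreasing in \<open>\<alpha>\<close>, because making both walks lazier moves equal mass to
  \<open>x\<close> and \<open>y\<close>, and bounded by 2, because most mass must travel from \<open>x\<close> to \<open>y\<close>.
\<close>

lemma LLY_curvature_tendsto:
  assumes wf: "wf_digraph (with_proj \<Gamma>)" and sc: "strongly_connected (with_proj \<Gamma>)"
    and x: "x \<in> pverts \<Gamma>" "finite (out_nbrs \<Gamma> x)" "out_nbrs \<Gamma> x \<noteq> {}" "x \<notin> out_nbrs \<Gamma> x"
    and y: "y \<in> pverts \<Gamma>" "finite (out_nbrs \<Gamma> y)" "out_nbrs \<Gamma> y \<noteq> {}" "y \<notin> out_nbrs \<Gamma> y"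
    and xy: "x \<noteq> y"
  shows "((\<lambda>\<alpha>. lazy_curvature \<Gamma> \<alpha> x y / (1 - \<alpha>)) \<longlongrightarrow> LLY_curvature \<Gamma> x y) (at_left 1)"
proof -
  define W where "W \<alpha> = rwasserstein \<Gamma> (lazy_walk \<Gamma> \<alpha> x) (lazy_walk \<Gamma> \<alpha> y)" for \<alpha>
  define d where "d = rdist \<Gamma> x y"
  have d: "0 < d"
    unfolding d_def by (rule rdist_pos[OF wf sc x(1) y(1) xy])
  have curv: "lazy_curvature \<Gamma> \<alpha> x y = 1 - W \<alpha> / d" for \<alpha>
    by (simp add: lazy_curvature_eq W_def d_def)
  have mono: "lazy_curvature \<Gamma> \<alpha> x y / (1 - \<alpha>) \<le> lazy_curvature \<Gamma> \<beta> x y / (1 - \<beta>)"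
    if \<alpha>: "0 \<le> \<alpha>" and \<alpha>\<beta>: "\<alpha> \<le> \<beta>" and \<beta>: "\<beta> < 1" for \<alpha> \<beta>
  proof -
    \<comment> \<open>The ratio of the masses that leave the start: the \<beta>-lazy walk is the
      \<alpha>-lazy one with weight \<open>t\<close> mixed with a point mass of weight
      \<open>1 - t\<close>.\<close>
    define t where "t = (1 - \<beta>) / (1 - \<alpha>)"
    have t: "0 < t" "t \<le> 1" and t_eq: "1 - \<beta> = t * (1 - \<alpha>)"
      using \<alpha>\<beta> \<beta> by (auto simp: t_def)
    from t_eq have \<beta>_eq: "\<beta> = t * \<alpha> + (1 - t)"
      by (simp add: algebra_simps)
    note cpl = couplings_lazy_walk_nonempty[OF x y \<alpha>]
    have "W \<beta> \<le> t * W \<alpha> + (1 - t) * d"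
      unfolding W_def d_def \<beta>_eq lazy_walk_lazier
    proof (rule rwasserstein_point_mass(2)[OF wf sc])
      show "couplings \<Gamma> (lazy_walk \<Gamma> \<alpha> x) (lazy_walk \<Gamma> \<alpha> y) \<noteq> {}"
        using cpl \<alpha>\<beta> \<beta> by simp
      show "t * lazy_walk \<Gamma> \<alpha> x u + (if u = x then 1 - t else 0) \<le> 1" for u
        using lazy_walk_le_1[of \<beta> \<Gamma> x u] \<alpha> \<alpha>\<beta> \<beta>
        by (simp add: \<beta>_eq lazy_walk_lazier)
      show "0 \<le> t * A x y + (1 - t)"
        if "A \<in> couplings \<Gamma> (lazy_walk \<Gamma> \<alpha> x) (lazy_walk \<Gamma> \<alpha> y)" for A
        using couplings_nonneg[OF that x(1) y(1)] t by simp
    qed (use x y t in \<open>simp_all add: finite_lazy_walk_support\<close>)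
    then have "W \<beta> / d \<le> (t * W \<alpha> + (1 - t) * d) / d"
      using d by (intro divide_right_mono) auto
    then have "t * (1 - W \<alpha> / d) \<le> 1 - W \<beta> / d"
      using d by (simp add: add_divide_distrib right_diff_distrib)
    then have "t * (1 - W \<alpha> / d) / (t * (1 - \<alpha>)) \<le> (1 - W \<beta> / d) / (1 - \<beta>)"
      unfolding t_eq[symmetric] using \<beta> by (intro divide_right_mono) auto
    then show ?thesis
      using t(1) by (simp add: curv)
  qed
  have bound: "lazy_curvature \<Gamma> \<alpha> x y / (1 - \<alpha>) \<le> 2" if \<alpha>: "0 \<le> \<alpha>" "\<alpha> < 1" for \<alpha>
  proof -
    define F where "F = insert (x, y) (support_pairs \<Gamma> (lazy_walk \<Gamma> \<alpha> x) (lazy_walk \<Gamma> \<alpha> y))"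
    have F: "finite F" "F \<subseteq> pverts \<Gamma> \<times> pverts \<Gamma>"
        "support_pairs \<Gamma> (lazy_walk \<Gamma> \<alpha> x) (lazy_walk \<Gamma> \<alpha> y) \<subseteq> F"
      using finite_support_pairs[OF finite_lazy_walk_support[OF x(2)] finite_lazy_walk_support[OF y(2)]]
        x(1) y(1) by (auto simp: F_def support_pairs_def)
    have ne: "couplings \<Gamma> (lazy_walk \<Gamma> \<alpha> x) (lazy_walk \<Gamma> \<alpha> y) \<noteq> {}"
      using couplings_lazy_walk_nonempty[OF x y] \<alpha> by simp
    \<comment> \<open>Only the pair \<open>(x, y)\<close> is kept in the cost. The constant 2 then
      comes from \<open>1 - (2 * \<alpha> - 1) = 2 * (1 - \<alpha>)\<close>.\<close>
    have "(2 * \<alpha> - 1) * d \<le> W \<alpha>"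
      unfolding W_def rwasserstein_eq[OF wf sc ne F]
    proof (rule cINF_greatest[OF ne])
      fix A assume A: "A \<in> couplings \<Gamma> (lazy_walk \<Gamma> \<alpha> x) (lazy_walk \<Gamma> \<alpha> y)"
      have "(2 * \<alpha> - 1) * d \<le> A x y * rdist \<Gamma> x y"
        unfolding d_def
        by (intro mult_right_mono coupling_lazy_walk_entry_ge[OF x(1) A y] rdist_nonneg[OF wf])
      also have "\<dots> = (\<Sum>(u, v)\<in>{(x, y)}. A u v * rdist \<Gamma> u v)"
        by simp
      also have "\<dots> \<le> transport_cost \<Gamma> F A"
        unfolding transport_cost_def using F(2)
        by (intro sum_mono2[OF F(1)])
          (auto simp: F_def intro!: mult_nonneg_nonneg couplings_nonneg[OF A] rdist_nonneg[OF wf])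
      finally show "(2 * \<alpha> - 1) * d \<le> transport_cost \<Gamma> F A" .
    qed
    then show ?thesis
      using d \<alpha> by (simp add: curv field_simps)
  qed
  \<comment> \<open>Monotonicity and the bound are known for nonnegative laziness only, so the limit
    is first taken within \<open>{0..}\<close>; near 1 this restriction changes nothing.\<close>
  have left: "at 1 within ({..<1} \<inter> {0..}) = at_left (1::real)"
    by (rule at_within_nhd[of _ "{0<..}"]) auto
  obtain l where "((\<lambda>\<alpha>. lazy_curvature \<Gamma> \<alpha> x y / (1 - \<alpha>)) \<longlongrightarrow> l) (at_left 1)"
    using Lim_left_bound[of "{0..}" 1 "\<lambda>\<alpha>. lazy_curvature \<Gamma> \<alpha> x y / (1 - \<alpha>)" 2] mono bound
    unfolding left by auto
  then show ?thesis
    unfolding LLY_curvature_def using tendsto_Lim[OF trivial_limit_at_left_real] by metis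
qed

section \<open>Directed Cayley graphs and the effect of a new generator\<close>

lemma pverts_cayley_digraph [simp]: "pverts (cayley_digraph G S) = carrier G"
  by (simp add: cayley_digraph_def)

context group
begin

lemma parcs_cayley_digraph_iff:
  "x \<in> carrier G \<Longrightarrow> (x, v) \<in> parcs (cayley_digraph G S) \<longleftrightarrow> v \<in> (\<otimes>) x ` S"
  by (auto simp: cayley_digraph_def)

lemma out_nbrs_cayley_digraph:
  assumes "x \<in> carrier G" and "S \<subseteq> carrier G"
  shows "out_nbrs (cayley_digraph G S) x = (\<otimes>) x ` S"
  using assms by (auto simp: out_nbrs_def parcs_cayley_digraph_iff)

lemma card_out_nbrs_cayley_digraph:
  assumes "x \<in> carrier G" and "S \<subseteq> carrier G"
  shows "card (out_nbrs (cayley_digraph G S) x) = card S"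
  unfolding out_nbrs_cayley_digraph[OF assms]
  using assms by (intro card_image inj_onI) (auto simp: subset_iff)

lemma loopfree_out_nbrs_cayley_digraph:
  assumes "x \<in> carrier G" and "S \<subseteq> carrier G - {\<one>}"
  shows "x \<notin> out_nbrs (cayley_digraph G S) x"
  using assms by (auto simp: out_nbrs_cayley_digraph subset_iff)

lemma lazy_walk_cayley_digraph:
  assumes "x \<in> carrier G" and "S \<subseteq> carrier G"
  shows "lazy_walk (cayley_digraph G S) \<alpha> x v =
    (if v = x then \<alpha> else if v \<in> (\<otimes>) x ` S then (1 - \<alpha>) / card S else 0)"
  using assms by (simp add: lazy_walk_def parcs_cayley_digraph_iff card_out_nbrs_cayley_digraph)

lemma rdist_cayley_generator:
  assumes "S \<subseteq> carrier G - {\<one>}" and "y \<in> S"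
  shows "rdist (cayley_digraph G S) \<one> y = 1"
proof -
  have S: "S \<subseteq> carrier G" and "y \<in> carrier G" and y: "\<one> \<noteq> y"
    using assms by auto
  then have "(\<one>, y) \<in> parcs (cayley_digraph G S)"
    using assms(2) by (force simp: parcs_cayley_digraph_iff)
  then show ?thesis
    using ddist_arc[OF cayley_digraph_wf[OF is_group S] _ y] by (simp add: rdist_def)
qed

lemma cayley_digraph_mono:
  assumes "S \<subseteq> S'" and "S' \<subseteq> carrier G"
  shows "subgraph (with_proj (cayley_digraph G S)) (with_proj (cayley_digraph G S'))"
  using assms cayley_digraph_wf[OF is_group, of S] cayley_digraph_wf[OF is_group, of S']
  by (auto simp: subgraph_def compatible_def) (auto simp: cayley_digraph_def)

lemma strongly_connected_cayley_digraph_mono: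
  assumes "S \<subseteq> S'" and "S' \<subseteq> carrier G"
    and "strongly_connected (with_proj (cayley_digraph G S))"
  shows "strongly_connected (with_proj (cayley_digraph G S'))"
proof -
  interpret wf_digraph "with_proj (cayley_digraph G S')"
    by (rule cayley_digraph_wf[OF is_group assms(2)])
  show ?thesis
    by (rule strongly_connected_spanning_imp_strongly_connected[OF _ assms(3)])
      (simp add: spanning_def cayley_digraph_mono[OF assms(1,2)])
qed

lemma cayley_LLY_curvature_tendsto:
  assumes S: "finite S" "S \<subseteq> carrier G - {\<one>}" "S \<noteq> {}"
    and sc: "strongly_connected (with_proj (cayley_digraph G S))"
    and xy: "x \<in> carrier G" "y \<in> carrier G" "x \<noteq> y"
  shows "((\<lambda>\<alpha>. lazy_curvature (cayley_digraph G S) \<alpha> x y / (1 - \<alpha>))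
    \<longlongrightarrow> LLY_curvature (cayley_digraph G S) x y) (at_left 1)"
proof -
  have "S \<subseteq> carrier G" using S(2) by blast
  then show ?thesis
    using S xy loopfree_out_nbrs_cayley_digraph[OF _ S(2)]
    by (intro LLY_curvature_tendsto cayley_digraph_wf[OF is_group] sc)
      (simp_all add: out_nbrs_cayley_digraph)
qed

text \<open>The factors 1 bring the right-hand side into the form of \<open>rwasserstein_point_mass\<close>, used twice.\<close>

lemma lazy_walk_cayley_insert:
  assumes S: "finite S" "S \<subseteq> carrier G - {\<one>}" and s: "s \<in> carrier G - {\<one>}" "s \<notin> S" and x: "x \<in> carrier G"
    and n: "n = card S" "0 < n"
    and \<beta>: "\<beta> = 1 - real n * (1 - \<alpha>) / (real n + 1)" and c: "c = (1 - \<alpha>) / (real n + 1)"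
  shows "lazy_walk (cayley_digraph G (insert s S)) \<alpha> x = (\<lambda>v. 1 *
    (1 * lazy_walk (cayley_digraph G S) \<beta> x v + (if v = x then - c else 0)) +
    (if v = x \<otimes> s then c else 0))"
proof
  fix v
  have sub: "S \<subseteq> carrier G" "insert s S \<subseteq> carrier G"
    using S s by auto
  have card: "real (card (insert s S)) = real n + 1"
    using S s n by simp
  have "x \<otimes> s \<noteq> x"
    using s x by simp
  moreover have "x \<otimes> s \<notin> (\<otimes>) x ` S"
    using s x sub by (auto simp: subset_iff)
  moreover have "real n * c + c = (real n + 1) * c"
    by (simp add: distrib_right)
  then have "real n * c + c = 1 - \<alpha>" and "1 - \<beta> = real n * c"
    by (simp_all add: \<beta> c)
  \<comment> \<open>Old neighbours receive the same mass \<open>c\<close> in both graphs; the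
    surplus \<beta> - \<alpha> at the start is exactly the share of the new neighbour.\<close>
  then have "(1 - \<beta>) / real n = c" and "\<beta> - c = \<alpha>"
    using n by auto
  ultimately show "lazy_walk (cayley_digraph G (insert s S)) \<alpha> x v = 1 *
    (1 * lazy_walk (cayley_digraph G S) \<beta> x v + (if v = x then - c else 0)) +
    (if v = x \<otimes> s then c else 0)"
    unfolding lazy_walk_cayley_digraph[OF x sub(1)] lazy_walk_cayley_digraph[OF x sub(2)] card n(1)[symmetric]
    by (auto simp: c)
qed

text \<open>The comparison before the limit. Mass \<open>c\<close> is removed from
  \<open>(\<one>, y)\<close> in the old graph, the distances of the new graph are substituted, and
  \<open>c\<close> is put back on \<open>(s, y \<otimes> s)\<close>. As \<open>y\<close> is at
  distance 1 from the identity in both graphs, the removal saves exactly \<open>c\<close> and the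
  curvatures have denominator 1.\<close>

lemma lazy_curvature_cayley_insert:
  assumes S: "finite S" "S \<subseteq> carrier G - {\<one>}" and y: "y \<in> S"
    and sc: "strongly_connected (with_proj (cayley_digraph G S))"
    and s: "s \<in> carrier G - {\<one>}" "s \<notin> S"
    and \<alpha>: "1 / 2 \<le> \<alpha>" "\<alpha> < 1"
  defines "n \<equiv> card S"
  defines "\<beta> \<equiv> 1 - real n * (1 - \<alpha>) / (real n + 1)"
  shows "lazy_curvature (cayley_digraph G S) \<beta> \<one> y
      + (1 - \<alpha>) / (real n + 1) * (1 - rdist (cayley_digraph G (insert s S)) s (y \<otimes> s))
    \<le> lazy_curvature (cayley_digraph G (insert s S)) \<alpha> \<one> y"
proof -
  define \<Gamma> where "\<Gamma> = cayley_digraph G S"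
  define \<Gamma>' where "\<Gamma>' = cayley_digraph G (insert s S)"
  define c where "c = (1 - \<alpha>) / (real n + 1)"
  \<comment> \<open>The common part of the two walks from \<open>x\<close>, of total mass
    \<open>1 - c\<close>: the old walk exceeds it by \<open>c\<close> at \<open>x\<close>, the new
    one by \<open>c\<close> at \<open>x \<otimes> s\<close>.\<close>
  define \<mu> where "\<mu> x = (\<lambda>v. 1 * lazy_walk \<Gamma> \<beta> x v + (if v = x then - c else 0))" for x
  have sub: "S \<subseteq> carrier G" "insert s S \<subseteq> carrier G" and y': "y \<in> carrier G" "y \<noteq> \<one>"
    using S s y by auto
  have n: "0 < n"
    using S(1) y by (auto simp: n_def card_gt_0_iff)
  have "real n * c + c = (real n + 1) * c"
    by (simp add: distrib_right)
  also have "\<dots> = 1 - \<alpha>"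
    by (simp add: c_def)
  finally have c: "0 \<le> c" "\<beta> = 1 - real n * c" "\<alpha> = 1 - real n * c - c"
    using \<alpha> by (auto simp: c_def \<beta>_def)
  have "0 \<le> real n * c"
    using c(1) by simp
  \<comment> \<open>Here \<alpha> \<ge> 1/2 enters: it says \<open>2 * (n + 1) * c \<le> 1\<close>,
    whence \<open>c \<le> 2 * \<beta> - 1\<close>, the mass that every coupling puts on
    \<open>(\<one>, y)\<close>.\<close>
  then have \<beta>: "0 \<le> \<beta>" "\<beta> \<le> 1" "c \<le> 2 * \<beta> - 1"
    using c \<alpha> by auto
  have wf: "wf_digraph (with_proj \<Gamma>)" "wf_digraph (with_proj \<Gamma>')"
    using cayley_digraph_wf[OF is_group] sub by (simp_all add: \<Gamma>_def \<Gamma>'_def)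
  have sc': "strongly_connected (with_proj \<Gamma>)" "strongly_connected (with_proj \<Gamma>')"
    using sc strongly_connected_cayley_digraph_mono[OF _ sub(2) sc] by (auto simp: \<Gamma>_def \<Gamma>'_def)
  have V: "pverts \<Gamma> = carrier G" "pverts \<Gamma>' = carrier G"
    by (simp_all add: \<Gamma>_def \<Gamma>'_def)
  have nbrs: "finite (out_nbrs \<Gamma> x)" "out_nbrs \<Gamma> x \<noteq> {}" "x \<notin> out_nbrs \<Gamma> x" if "x \<in> carrier G" for x
    using out_nbrs_cayley_digraph[OF that sub(1)] S y loopfree_out_nbrs_cayley_digraph[OF that S(2)]
    by (auto simp: \<Gamma>_def)
  have arc: "rdist \<Gamma> \<one> y = 1" "rdist \<Gamma>' \<one> y = 1"
    using S s y by (auto simp: \<Gamma>_def \<Gamma>'_def intro!: rdist_cayley_generator)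
  have walk': "lazy_walk \<Gamma>' \<alpha> x = (\<lambda>v. 1 * \<mu> x v + (if v = x \<otimes> s then c else 0))"
    if "x \<in> carrier G" for x
    unfolding \<Gamma>'_def \<mu>_def \<Gamma>_def
    by (rule lazy_walk_cayley_insert[OF S s that n_def[THEN meta_eq_to_obj_eq] n
          \<beta>_def[THEN meta_eq_to_obj_eq] c_def])
  have le1: "\<mu> x v \<le> 1" for x v
    using lazy_walk_le_1[OF \<beta>(1,2), of \<Gamma> x v] c(1) by (auto simp: \<mu>_def)
  have fin: "finite {v \<in> carrier G. \<mu> x v \<noteq> 0}" if "x \<in> carrier G" for x
    unfolding \<mu>_def
    using finite_lazy_walk_support[OF nbrs(1)[OF that]] by (intro finite_point_mass) (simp add: V)
  have ne_lazy: "couplings \<Gamma> (lazy_walk \<Gamma> \<beta> \<one>) (lazy_walk \<Gamma> \<beta> y) \<noteq> {}"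
    using nbrs y' \<beta> by (intro couplings_lazy_walk_nonempty) (simp_all add: V)
  have nonneg: "0 \<le> 1 * A \<one> y + (- c)"
    if "A \<in> couplings \<Gamma> (lazy_walk \<Gamma> \<beta> \<one>) (lazy_walk \<Gamma> \<beta> y)" for A
    using coupling_lazy_walk_entry_ge[OF _ that] nbrs y' \<beta>(3) by (force simp: V)
  have fin_lazy: "finite {v \<in> pverts \<Gamma>. lazy_walk \<Gamma> \<beta> x v \<noteq> 0}" if "x \<in> carrier G" for x
    by (rule finite_lazy_walk_support[OF nbrs(1)[OF that]])
  have verts: "\<one> \<in> pverts \<Gamma>" "y \<in> pverts \<Gamma>"
    using y' by (simp_all add: V)
  have le1_lazy: "1 * lazy_walk \<Gamma> \<beta> \<one> v + (if v = \<one> then - c else 0) \<le> 1" for v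
    using le1[of \<one> v] by (simp add: \<mu>_def)
  have ne_\<mu>: "couplings \<Gamma> (\<mu> \<one>) (\<mu> y) \<noteq> {}"
    unfolding \<mu>_def
    by (rule rwasserstein_point_mass(1)[OF wf(1) sc'(1) ne_lazy])
      (use fin_lazy verts nonneg le1_lazy y' in simp_all)
  have remove: "rwasserstein \<Gamma> (\<mu> \<one>) (\<mu> y) \<le>
      1 * rwasserstein \<Gamma> (lazy_walk \<Gamma> \<beta> \<one>) (lazy_walk \<Gamma> \<beta> y) + (- c) * rdist \<Gamma> \<one> y"
    unfolding \<mu>_def
    by (rule rwasserstein_point_mass(2)[OF wf(1) sc'(1) ne_lazy])
      (use fin_lazy verts nonneg le1_lazy y' in simp_all)
  have ne': "couplings \<Gamma>' (\<mu> \<one>) (\<mu> y) \<noteq> {}"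
    using ne_\<mu> by (simp add: couplings_def V)
  have sG: "s \<in> carrier G" using s by blast
  have le1': "1 * \<mu> \<one> v + (if v = s then c else 0) \<le> 1" for v
    using lazy_walk_le_1[of \<alpha> \<Gamma>' \<one> v] \<alpha> unfolding walk'[OF one_closed] l_one[OF sG] by simp
  have "rwasserstein \<Gamma>' (lazy_walk \<Gamma>' \<alpha> \<one>) (lazy_walk \<Gamma>' \<alpha> y) \<le>
      1 * rwasserstein \<Gamma>' (\<mu> \<one>) (\<mu> y) + c * rdist \<Gamma>' s (y \<otimes> s)"
    unfolding walk'[OF one_closed] walk'[OF y'(1)] l_one[OF sG]
  proof (rule rwasserstein_point_mass(2)[OF wf(2) sc'(2) ne'])
    show "0 \<le> 1 * A s (y \<otimes> s) + c" if "A \<in> couplings \<Gamma>' (\<mu> \<one>) (\<mu> y)" for A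
      using couplings_nonneg[OF that, of s "y \<otimes> s"] sG y'(1) c(1) by (simp add: V)
  qed (use sG y'(1) fin le1' in \<open>simp_all add: V\<close>)
  \<comment> \<open>The change of graph takes place at the intermediate measures, which are the same
    for both graphs.\<close>
  also have "rwasserstein \<Gamma>' (\<mu> \<one>) (\<mu> y) \<le> rwasserstein \<Gamma> (\<mu> \<one>) (\<mu> y)"
    using cayley_digraph_mono[OF _ sub(2)] ne_\<mu> fin y'(1)
    by (intro rwasserstein_mono_dist[OF wf(1) sc'(1) wf(2) sc'(2)])
      (auto simp: V \<Gamma>_def \<Gamma>'_def)
  also note remove
  finally show ?thesis
    unfolding lazy_curvature_eq \<Gamma>_def[symmetric] \<Gamma>'_def[symmetric] arc c_def[symmetric]
    by (simp add: algebra_simps arc)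
qed

end

section \<open>Passage to the limit\<close>

theorem theorem3p17:
  fixes G :: "('a, 'm) monoid_scheme"
    and s :: "nat \<Rightarrow> 'a"
    and r i :: nat
    and S S' :: "'a set"
  assumes "group G"
    and "S = s ` {1..r}" and "inj_on s {1..r}"
    and "S \<subseteq> carrier G - {\<one>\<^bsub>G\<^esub>}"
    and "generate G S = carrier G"
    and "strongly_connected (with_proj (cayley_digraph G S))"
    and "s (r + 1) \<in> carrier G - {\<one>\<^bsub>G\<^esub>}" and "s (r + 1) \<notin> S"
    and "S' = S \<union> {s (r + 1)}"
    and "i \<in> {1..r}"
    and "LLY_curvature (cayley_digraph G S) \<one>\<^bsub>G\<^esub> (s i)
      \<le> 1 - real_of_ereal (ddist (cayley_digraph G S') (s (r + 1)) (s i \<otimes>\<^bsub>G\<^esub> s (r + 1)))"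
  shows "LLY_curvature (cayley_digraph G S') \<one>\<^bsub>G\<^esub> (s i)
      \<ge> LLY_curvature (cayley_digraph G S) \<one>\<^bsub>G\<^esub> (s i)"
proof -
  interpret group G by fact
  define t where "t = s (r + 1)"
  define y where "y = s i"
  have S: "finite S" "S \<subseteq> carrier G - {\<one>\<^bsub>G\<^esub>}" and y: "y \<in> S" and r: "card S = r" "0 < r"
    using assms(2-4,10) by (auto simp: y_def card_image)
  have t: "t \<in> carrier G - {\<one>\<^bsub>G\<^esub>}" "t \<notin> S" and S': "S' = insert t S"
    using assms(7-9) by (auto simp: t_def)
  have yG: "y \<in> carrier G" "\<one>\<^bsub>G\<^esub> \<noteq> y"
    using S y by auto
  have sc': "strongly_connected (with_proj (cayley_digraph G S'))"
    using S t S' by (intro strongly_connected_cayley_digraph_mono[OF _ _ assms(6)]) auto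
  define \<kappa> where "\<kappa> = LLY_curvature (cayley_digraph G S) \<one>\<^bsub>G\<^esub> y"
  define \<kappa>' where "\<kappa>' = LLY_curvature (cayley_digraph G S') \<one>\<^bsub>G\<^esub> y"
  define D where "D = rdist (cayley_digraph G S') t (y \<otimes>\<^bsub>G\<^esub> t)"
  define \<beta> where "\<beta> \<alpha> = 1 - real r * (1 - \<alpha>) / (real r + 1)" for \<alpha>
  \<comment> \<open>The ratio of 1 - \<beta> to 1 - \<alpha>, which rescales the old curvature
    quotient after division by 1 - \<alpha>.\<close>
  define q where "q = real r / (real r + 1)"
  have hyp: "\<kappa> \<le> 1 - D"
    using assms(11) by (simp add: \<kappa>_def D_def rdist_def t_def y_def)
  have q: "0 < q" "q < 1" "1 / (real r + 1) = 1 - q"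
    using r by (auto simp: q_def field_simps)
  have \<beta>: "1 - \<beta> \<alpha> = q * (1 - \<alpha>)" for \<alpha>
    by (simp add: \<beta>_def q_def)
  have lim: "((\<lambda>\<alpha>. lazy_curvature (cayley_digraph G S) \<alpha> \<one>\<^bsub>G\<^esub> y / (1 - \<alpha>)) \<longlongrightarrow> \<kappa>) (at_left 1)"
    unfolding \<kappa>_def using S y yG by (intro cayley_LLY_curvature_tendsto assms(6)) auto
  have lim': "((\<lambda>\<alpha>. lazy_curvature (cayley_digraph G S') \<alpha> \<one>\<^bsub>G\<^esub> y / (1 - \<alpha>)) \<longlongrightarrow> \<kappa>') (at_left 1)"
    unfolding \<kappa>'_def using S t S' yG by (intro cayley_LLY_curvature_tendsto sc') auto
  \<comment> \<open>The substitution must approach 1 strictly from the left, so that the one-sided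
    limit of the old quotient can be composed with it.\<close>
  have "filterlim \<beta> (at_left 1) (at_left 1)"
    unfolding filterlim_at
  proof
    show "\<forall>\<^sub>F \<alpha> in at_left 1. \<beta> \<alpha> \<in> {..<1} \<and> \<beta> \<alpha> \<noteq> 1"
      using r by (auto simp: \<beta>_def eventually_at_filter)
    have "(\<beta> \<longlongrightarrow> 1 - real r * (1 - 1) / (real r + 1)) (at_left 1)"
      unfolding \<beta>_def by (intro tendsto_intros) auto
    then show "(\<beta> \<longlongrightarrow> 1) (at_left 1)" by simp
  qed
  from filterlim_compose[OF lim this]
  have "((\<lambda>\<alpha>. q * (lazy_curvature (cayley_digraph G S) (\<beta> \<alpha>) \<one>\<^bsub>G\<^esub> y / (1 - \<beta> \<alpha>)) + (1 - q) * (1 - D))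
      \<longlongrightarrow> q * \<kappa> + (1 - q) * (1 - D)) (at_left 1)"
    by (intro tendsto_intros)
  moreover have "\<forall>\<^sub>F \<alpha> in at_left 1.
      q * (lazy_curvature (cayley_digraph G S) (\<beta> \<alpha>) \<one>\<^bsub>G\<^esub> y / (1 - \<beta> \<alpha>)) + (1 - q) * (1 - D)
      \<le> lazy_curvature (cayley_digraph G S') \<alpha> \<one>\<^bsub>G\<^esub> y / (1 - \<alpha>)"
  proof (rule eventually_at_leftI[of "1 / 2"])
    fix \<alpha> :: real assume \<alpha>: "\<alpha> \<in> {1 / 2<..<1}"
    have "lazy_curvature (cayley_digraph G S) (\<beta> \<alpha>) \<one>\<^bsub>G\<^esub> y + (1 - \<alpha>) * (1 - q) * (1 - D)
        \<le> lazy_curvature (cayley_digraph G S') \<alpha> \<one>\<^bsub>G\<^esub> y"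
      using lazy_curvature_cayley_insert[OF S y assms(6) t, of \<alpha>] \<alpha>
      by (simp add: r \<beta>_def S' D_def flip: q(3))
    then have "(lazy_curvature (cayley_digraph G S) (\<beta> \<alpha>) \<one>\<^bsub>G\<^esub> y + (1 - \<alpha>) * ((1 - q) * (1 - D))) / (1 - \<alpha>)
        \<le> lazy_curvature (cayley_digraph G S') \<alpha> \<one>\<^bsub>G\<^esub> y / (1 - \<alpha>)"
      using \<alpha> by (intro divide_right_mono) (simp_all add: mult.assoc)
    then show "q * (lazy_curvature (cayley_digraph G S) (\<beta> \<alpha>) \<one>\<^bsub>G\<^esub> y / (1 - \<beta> \<alpha>)) + (1 - q) * (1 - D)
        \<le> lazy_curvature (cayley_digraph G S') \<alpha> \<one>\<^bsub>G\<^esub> y / (1 - \<alpha>)"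
      using \<alpha> q(1) by (simp add: \<beta> add_divide_distrib)
  qed simp
  ultimately have "q * \<kappa> + (1 - q) * (1 - D) \<le> \<kappa>'"
    using tendsto_le[OF trivial_limit_at_left_real lim'] by blast
  \<comment> \<open>The lower bound for \<kappa>' is a convex combination of \<kappa> and
    \<open>1 - D\<close>, and the hypothesis makes the second term at least \<kappa>.\<close>
  moreover have "(1 - q) * \<kappa> \<le> (1 - q) * (1 - D)"
    using hyp q by (intro mult_left_mono) auto
  ultimately have "\<kappa> \<le> \<kappa>'"
    by (simp add: algebra_simps)
  then show ?thesis
    by (simp add: \<kappa>_def \<kappa>'_def y_def)
qed

end
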